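(* Let $\mathscr{A}$ be a Banach algebra with unit $I$, and let $P, Q \in \mathscr{A}$ be idempotents with $PQP = P$. Then for any nonzero scalars $a$ and $b$, the element $aP+bQ$ is Drazin invertible, and $$(aP+bQ)^D=\begin{cases}\dfrac{a^2}{(a+b)^3}P+\dfrac{1}{b}Q+\dfrac{ab}{(a+b)^3}(PQ+QP)+\Big(\dfrac{b^2}{(a+b)^3}-\dfrac{1}{b}\Big)QPQ, & \text{if } a+b\neq 0;\\[2mm] \dfrac{1}{a}Q(P-I)Q, & \text{if } a+b=0.\end{cases}$$ Moreover, $\operatorname{ind}(aP-aQ)\le 3$, and $\operatorname{ind}(aP+bQ)\le 2$ when $a+b\neq 0$.
   Context: An element $P \in \mathscr{A}$ is an idempotent if $P^2=P$. An element $A \in \mathscr{A}$ is Drazin invertible if there is $B \in \mathscr{A}$ with $BAB=B$, $AB=BA$ and $A^{k+1}B=A^k$ for some nonnegative integer $k$ (with $A^0=I$). Such a $B$ is unique, is called the Drazin inverse of $A$ and is denoted $A^D$. The least such $k$ is the index of $A$, denoted $\operatorname{ind}(A)$. Scalars are elements of the base field of $\mathscr{A}$. *)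

theory Defs
  imports Complex_Main
begin

text \<open>
  Unital Banach algebras over a base field \<open>'k\<close>. Up to isometric isomorphism, the types of class
  \<^class>\<open>real_normed_field\<close> are just \<open>\<real>\<close> and \<open>\<complex>\<close>, so this covers both real and complex Banach
  algebras, with \<open>scale\<close> the multiplication by scalars of the base field. Compatibility of \<open>scale\<close>
  with the \<open>scaleR\<close> of the type class is automatic: \<open>\<lambda>r. scale (of_real r) x\<close> is additive,
  bounded by \<open>\<bar>r\<bar> * norm x\<close>, and maps \<open>1\<close> to \<open>x\<close>. The class \<^class>\<open>monoid_mult\<close> supplies the unit,
  on whose norm nothing is assumed.
\<close>

locale banach_algebra = vector_space scale
  for scale :: "'k::real_normed_field \<Rightarrow> 'a::{real_normed_algebra, monoid_mult, banach} \<Rightarrow> 'a" +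
  assumes scale_mult_left: "scale c x * y = scale c (x * y)"
    and scale_mult_right: "x * scale c y = scale c (x * y)"
    and norm_scale: "norm (scale c x) = norm c * norm x"

lemma banach_algebra_scaleR:
  "banach_algebra (scaleR :: real \<Rightarrow> 'a::{real_normed_algebra, monoid_mult, banach} \<Rightarrow> 'a)"
  by unfold_locales (simp_all add: algebra_simps)

lemma banach_algebra_complex: "banach_algebra ((*) :: complex \<Rightarrow> complex \<Rightarrow> complex)"
  by unfold_locales (simp_all add: algebra_simps norm_mult)

definition is_drazin_inverse :: "'a::monoid_mult \<Rightarrow> 'a \<Rightarrow> bool" where
  "is_drazin_inverse A B \<longleftrightarrow>
     B * A * B = B \<and> A * B = B * A \<and> (\<exists>k::nat. A ^ (k + 1) * B = A ^ k)"

definition drazin_invertible :: "'a::monoid_mult \<Rightarrow> bool" where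
  "drazin_invertible A \<longleftrightarrow> (\<exists>B. is_drazin_inverse A B)"

definition drazin_inverse :: "'a::monoid_mult \<Rightarrow> 'a" where
  "drazin_inverse A = (THE B. is_drazin_inverse A B)"

definition drazin_index :: "'a::monoid_mult \<Rightarrow> nat" where
  "drazin_index A = (LEAST k. A ^ (k + 1) * drazin_inverse A = A ^ k)"

lemma drazin_power_mono:
  fixes A B :: "'a::monoid_mult"
  assumes "A ^ (k + 1) * B = A ^ k" "k \<le> m"
  shows "A ^ (m + 1) * B = A ^ m"
proof -
  have "A ^ (m + 1) * B = A ^ (m - k) * (A ^ (k + 1) * B)"
    using assms(2) by (simp flip: mult.assoc power_Suc power_add)
  also have "\<dots> = A ^ m"
    using assms by (simp flip: power_add)
  finally show ?thesis .
qed

lemma drazin_expand: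
  fixes A B :: "'a::monoid_mult"
  assumes "B * A * B = B" "A * B = B * A"
  shows "B = B ^ (n + 1) * A ^ n"
proof (induction n)
  case (Suc n)
  have com: "A * B ^ j = B ^ j * A" for j
    using assms(2) by (metis power_commuting_commutes)
  have "B ^ (Suc n + 1) * A ^ Suc n = B * (B ^ (n + 1) * A) * A ^ n"
    by (simp add: mult.assoc)
  also have "\<dots> = B * (A * B ^ (n + 1)) * A ^ n"
    by (simp only: com)
  also have "\<dots> = B * A * (B ^ (n + 1) * A ^ n)"
    by (simp add: mult.assoc)
  also have "\<dots> = B * A * B"
    using Suc.IH by argo
  finally show ?case using assms(1) by simp
qed simp

lemma is_drazin_inverse_unique:
  fixes A B C :: "'a::monoid_mult"
  assumes "is_drazin_inverse A B" "is_drazin_inverse A C"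
  shows "B = C"
proof -
  obtain k l where kl: "A ^ (k + 1) * B = A ^ k" "A ^ (l + 1) * C = A ^ l"
    using assms unfolding is_drazin_inverse_def by blast
  define m where "m = max k l"
  have m: "A ^ (m + 1) * B = A ^ m" "A ^ (m + 1) * C = A ^ m"
    using drazin_power_mono kl by (metis m_def max.cobounded1, metis m_def max.cobounded2)
  have B: "B * A * B = B" "A * B = B * A" and C: "C * A * C = C" "A * C = C * A"
    using assms unfolding is_drazin_inverse_def by auto
  have comm: "X ^ i * A ^ j = A ^ j * X ^ i" if "A * X = X * A" for X i j
    using that by (metis power_commuting_commutes)
  have "B = B ^ (m + 1) * A ^ m" using drazin_expand B by blast
  also have "\<dots> = B ^ (m + 1) * A ^ (m + 1) * C" by (simp only: m(2) mult.assoc)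
  also have "\<dots> = B ^ (m + 1) * A ^ m * (A * C)" by (metis mult.assoc power_Suc2 Suc_eq_plus1)
  also have "\<dots> = B * A * C" using drazin_expand[OF B, of m] by (simp add: mult.assoc)
  finally have 1: "B = B * A * C" .
  have "C = C ^ (m + 1) * A ^ m" using drazin_expand C by blast
  also have "\<dots> = A ^ m * C ^ (m + 1)" using comm C by blast
  also have "\<dots> = B * A * (A ^ m * C ^ (m + 1))"
  proof -
    have "A ^ m = A ^ (m + 1) * B" using m by simp
    also have "\<dots> = B * A ^ (m + 1)" using comm[OF B(2), of 1 "m + 1"] by simp
    finally show ?thesis by (metis mult.assoc power_Suc Suc_eq_plus1)
  qed
  also have "\<dots> = B * A * C" using drazin_expand[OF C, of m] comm[OF C(2), of "m + 1" m] by simp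
  finally show ?thesis using 1 by simp
qed

end

theory Submission
  imports Defs
begin

text \<open>
  The element \<open>A = aP + bQ\<close> splits into two parts that annihilate each other. Put \<open>R = QPQ\<close> and
  \<open>S = Q - R\<close>. By \<open>PQP = P\<close>, \<open>S\<close> is an idempotent with \<open>PS = SP = RS = SR = 0\<close>, so \<open>A = T + bS\<close>
  with \<open>T = aP + bR\<close> and \<open>T S = S T = 0\<close>. The Drazin inverse of such an orthogonal sum is the sum of
  the Drazin inverses (\<open>drazin_witness_orthogonal_sum\<close>), and that of \<open>bS\<close> is \<open>S / b\<close>, with index
  at most 1.

  It remains to treat \<open>T\<close>. The idempotents \<open>P\<close> and \<open>R\<close> satisfy \<open>PRP = P\<close> and \<open>RPR = R\<close>, so they
  generate a rectangular band: \<open>x y z = x z\<close> for all \<open>x, y, z\<close> among \<open>P\<close> and \<open>R\<close>. Replacing the middle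
  factor of \<open>T T T\<close> by \<open>aP + bR\<close> therefore only multiplies by the scalar \<open>a + b\<close>, that is,
  \<open>T^3 = (a + b) T^2\<close> (\<open>rectangular_band_cube\<close>). If \<open>c = a + b\<close> is nonzero, then \<open>T\<close> acts as the
  scalar \<open>c\<close> on \<open>T^2\<close>, which makes \<open>T^2 / c^3\<close> the Drazin inverse, of index at most 2. If \<open>c = 0\<close>,
  then \<open>T^3 = 0\<close>, so \<open>T\<close> has Drazin inverse 0 and index at most 3. Expanding
  \<open>T^2 = a^2 P + ab (PQ + QP) + b^2 QPQ\<close> gives the formula.
\<close>

text \<open>
  Keeping the exponent explicit lets one computation yield the Drazin inverse together with
  the upper bound \<open>k\<close> for the index.
\<close>

definition drazin_witness :: "nat \<Rightarrow> 'a::monoid_mult \<Rightarrow> 'a \<Rightarrow> bool" where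
  "drazin_witness k A B \<longleftrightarrow> B * A * B = B \<and> A * B = B * A \<and> A ^ (k + 1) * B = A ^ k"

lemma drazin_witness_mono:
  "drazin_witness k A B \<Longrightarrow> k \<le> m \<Longrightarrow> drazin_witness m A B"
  using drazin_power_mono unfolding drazin_witness_def by blast

lemma drazin_witnessD:
  fixes A B :: "'a::monoid_mult"
  assumes "drazin_witness k A B"
  shows "drazin_invertible A" and "drazin_inverse A = B" and "drazin_index A \<le> k"
proof -
  have B: "is_drazin_inverse A B"
    using assms unfolding drazin_witness_def is_drazin_inverse_def by blast
  then show "drazin_invertible A"
    unfolding drazin_invertible_def by blast
  show inv: "drazin_inverse A = B"
    unfolding drazin_inverse_def using B is_drazin_inverse_unique by blast
  show "drazin_index A \<le> k"
    unfolding drazin_index_def inv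
    using assms by (intro Least_le) (simp add: drazin_witness_def)
qed

lemma power_orthogonal_sum:
  fixes T U :: "'a::{ring, monoid_mult}"
  assumes "T * U = 0" and "U * T = 0"
  shows "(T + U) ^ Suc n = T ^ Suc n + U ^ Suc n"
proof (induction n)
  case (Suc n)
  have "T * U ^ Suc n = 0" "U * T ^ Suc n = 0"
    using assms by (simp_all flip: mult.assoc)
  then show ?case
    using Suc.IH by (simp add: algebra_simps)
qed simp

text \<open>
  From \<open>X = X T X\<close> and \<open>T X = X T\<close> one gets \<open>X = X X T = T X X\<close>, so \<open>X\<close> is annihilated by everything
  that annihilates \<open>T\<close>; hence all mixed products vanish. The exponent has to be positive because
  \<open>(T + U)^0\<close> is not \<open>T^0 + U^0\<close>.
\<close>

lemma drazin_witness_orthogonal_sum: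
  fixes T U X Y :: "'a::{ring, monoid_mult}"
  assumes T: "drazin_witness k T X" and U: "drazin_witness k U Y"
    and TU: "T * U = 0" and UT: "U * T = 0" and "k > 0"
  shows "drazin_witness k (T + U) (X + Y)"
proof -
  obtain n where k: "k = Suc n"
    using \<open>k > 0\<close> gr0_implies_Suc by blast
  have X: "X * T * X = X" "T * X = X * T" and Y: "Y * U * Y = Y" "U * Y = Y * U"
    using T U unfolding drazin_witness_def by auto
  have X': "X = X * X * T" "X = T * X * X" and Y': "Y = Y * Y * U" "Y = U * Y * Y"
    using X Y by (metis mult.assoc)+
  have XU: "X * U = 0" and UX: "U * X = 0"
    using X' TU UT by (metis mult.assoc mult_zero_left mult_zero_right)+
  have YT: "Y * T = 0" and TY: "T * Y = 0"
    using Y' TU UT by (metis mult.assoc mult_zero_left mult_zero_right)+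
  have "T ^ (k + 1) * Y = 0" "U ^ (k + 1) * X = 0"
    using TY UX by (simp_all add: mult.assoc power_Suc2 del: power_Suc)
  then have "(T + U) ^ (k + 1) * (X + Y) = T ^ (k + 1) * X + U ^ (k + 1) * Y"
    using power_orthogonal_sum[OF TU UT, of k] by (simp add: algebra_simps del: power_Suc)
  also have "\<dots> = (T + U) ^ k"
    using T U power_orthogonal_sum[OF TU UT, of n] unfolding drazin_witness_def k by simp
  finally have pow: "(T + U) ^ (k + 1) * (X + Y) = (T + U) ^ k" .
  have comm: "(T + U) * (X + Y) = (X + Y) * (T + U)"
    using X(2) Y(2) XU UX YT TY by (simp add: algebra_simps)
  have "X * U * Y = 0" "Y * T * X = 0" "X * T * Y = 0" "Y * U * X = 0"
    using XU YT TY UX by (simp_all add: mult.assoc)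
  then have "(X + Y) * (T + U) * (X + Y) = X + Y"
    using X(1) Y(1) XU YT by (simp add: distrib_left distrib_right)
  with comm pow show ?thesis
    unfolding drazin_witness_def by blast
qed

lemma drazin_witness_nilpotent:
  fixes T :: "'a::{ring, monoid_mult}"
  assumes "T * T * T = 0"
  shows "drazin_witness 3 T 0"
  using assms by (simp add: drazin_witness_def numeral_3_eq_3 mult.assoc)

context banach_algebra
begin

lemma drazin_witness_scale_idempotent:
  assumes "S * S = S" and "b \<noteq> 0"
  shows "drazin_witness 1 (scale b S) (scale (1 / b) S)"
  using assms by (simp add: drazin_witness_def scale_mult_left scale_mult_right)

text \<open>
  \<open>T\<close> multiplies \<open>T^2\<close> by \<open>c\<close>, so \<open>T^2 / c^2\<close> is an idempotent on whose range \<open>T\<close> is the scalar \<open>c\<close>.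
  The Drazin inverse is \<open>1 / c\<close> times that idempotent.
\<close>

lemma drazin_witness_cube_eq_scale_square:
  assumes "T * T * T = scale c (T * T)" and "c \<noteq> 0"
  shows "drazin_witness 2 T (scale (1 / c ^ 3) (T * T))"
proof -
  have T3: "T * (T * T) = scale c (T * T)"
    using assms(1) by (simp add: mult.assoc)
  then have T5: "T * (T * (T * (T * T))) = scale (c ^ 3) (T * T)"
    by (simp add: scale_mult_right power3_eq_cube)
  then show ?thesis
    using assms(2)
    by (simp add: drazin_witness_def numeral_2_eq_2 mult.assoc scale_mult_left scale_mult_right)
qed

lemma rectangular_band_cube:
  fixes P R a b
  assumes P: "P * P = P" and R: "R * R = R" and PRP: "P * R * P = P" and RPR: "R * P * R = R"
  defines "T \<equiv> scale a P + scale b R"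
  shows "T * T * T = scale (a + b) (T * T)"
proof -
  have middle: "x * T * z = scale (a + b) (x * z)" if "x = P \<or> x = R" "z = P \<or> z = R" for x z
  proof -
    have "x * P * z = x * z" "x * R * z = x * z"
      using that P R PRP RPR by (metis mult.assoc)+
    then show ?thesis
      by (simp add: T_def distrib_left distrib_right scale_mult_left scale_mult_right
          scale_left_distrib)
  qed
  \<comment> \<open>Only the outer factors are expanded, so that the middle factor can be absorbed.\<close>
  have outer: "T * X * T = scale a (scale a (P * X * P)) + scale a (scale b (P * X * R))
      + scale b (scale a (R * X * P)) + scale b (scale b (R * X * R))" for X
    by (simp add: T_def distrib_left distrib_right scale_mult_left scale_mult_right
        scale_right_distrib mult.commute)
  show ?thesis
    using outer[of T] outer[of 1] middle
    by (simp add: scale_right_distrib mult.commute mult.left_commute)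
qed

lemma drazin_witness_idempotent_combination:
  assumes P: "P * P = P" and Q: "Q * Q = Q" and PQP: "P * Q * P = P" and "b \<noteq> 0"
  shows "a + b \<noteq> 0 \<Longrightarrow> drazin_witness 2 (scale a P + scale b Q)
      (scale (a ^ 2 / (a + b) ^ 3) P + scale (1 / b) Q
        + scale (a * b / (a + b) ^ 3) (P * Q + Q * P)
        + scale (b ^ 2 / (a + b) ^ 3 - 1 / b) (Q * P * Q))"
    and "a + b = 0 \<Longrightarrow> drazin_witness 3 (scale a P + scale b Q)
      (scale (1 / a) (Q * (P - 1) * Q))"
proof -
  define R where "R = Q * P * Q"
  define S where "S = Q - R"
  define T where "T = scale a P + scale b R"
  \<comment> \<open>Rewriting by these rules brings every word in \<open>P\<close> and \<open>Q\<close> to one of \<open>P, Q, PQ, QP, QPQ\<close>.\<close>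
  have QQ: "Q * (Q * x) = Q * x" and PP: "P * (P * x) = P * x" for x
    using P Q by (simp_all flip: mult.assoc)
  have PQP1: "P * (Q * P) = P" and PQP2: "P * (Q * (P * x)) = P * x" for x
    using PQP by (simp_all flip: mult.assoc)
  note words = mult.assoc P Q QQ PP PQP1 PQP2
  have PR: "P * R = P * Q" and RP: "R * P = Q * P" and RR: "R * R = R"
    and PRP: "P * R * P = P" and RPR: "R * P * R = R"
    unfolding R_def by (simp_all add: words)
  have SS: "S * S = S" and "P * S = 0" "S * P = 0" "R * S = 0" "S * R = 0"
    unfolding S_def R_def by (simp_all add: left_diff_distrib right_diff_distrib words)
  then have TS: "T * scale b S = 0" and ST: "scale b S * T = 0"
    by (simp_all add: T_def distrib_left distrib_right scale_mult_left scale_mult_right)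
  have split: "scale a P + scale b Q = T + scale b S"
    by (simp add: T_def S_def scale_right_diff_distrib)
  have S: "drazin_witness 1 (scale b S) (scale (1 / b) S)"
    using drazin_witness_scale_idempotent[OF SS \<open>b \<noteq> 0\<close>] .
  have T3: "T * T * T = scale (a + b) (T * T)"
    unfolding T_def using rectangular_band_cube[OF P RR PRP RPR] .
  {
    assume c: "a + b \<noteq> 0"
    have "T * T = scale (a ^ 2) P + scale (a * b) (P * Q + Q * P) + scale (b ^ 2) R"
      by (simp add: T_def distrib_left distrib_right scale_mult_left scale_mult_right
          scale_right_distrib P RR PR RP power2_eq_square mult.commute)
    then have inv: "scale (1 / (a + b) ^ 3) (T * T) + scale (1 / b) S =
      scale (a ^ 2 / (a + b) ^ 3) P + scale (1 / b) Q
        + scale (a * b / (a + b) ^ 3) (P * Q + Q * P)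
        + scale (b ^ 2 / (a + b) ^ 3 - 1 / b) R"
      by (simp add: S_def scale_right_distrib scale_right_diff_distrib scale_left_diff_distrib)
    have "drazin_witness 2 (T + scale b S)
        (scale (1 / (a + b) ^ 3) (T * T) + scale (1 / b) S)"
      using drazin_witness_cube_eq_scale_square[OF T3 c] drazin_witness_mono[OF S] TS ST
      by (intro drazin_witness_orthogonal_sum) simp_all
    then show "drazin_witness 2 (scale a P + scale b Q)
      (scale (a ^ 2 / (a + b) ^ 3) P + scale (1 / b) Q
        + scale (a * b / (a + b) ^ 3) (P * Q + Q * P)
        + scale (b ^ 2 / (a + b) ^ 3 - 1 / b) (Q * P * Q))"
      unfolding inv split R_def .
  next
    assume c: "a + b = 0"
    then have b: "b = - a"
      by (simp add: eq_neg_iff_add_eq_0 add.commute)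
    have "Q * (P - 1) * Q = - S"
      by (simp add: S_def R_def left_diff_distrib right_diff_distrib Q)
    then have inv: "0 + scale (1 / b) S = scale (1 / a) (Q * (P - 1) * Q)"
      by (simp add: b)
    have "drazin_witness 3 (T + scale b S) (0 + scale (1 / b) S)"
      using drazin_witness_nilpotent[of T] T3 c drazin_witness_mono[OF S] TS ST
      by (intro drazin_witness_orthogonal_sum) simp_all
    then show "drazin_witness 3 (scale a P + scale b Q) (scale (1 / a) (Q * (P - 1) * Q))"
      unfolding inv split .
  }
qed

end

theorem theorem2p2:
  fixes scale :: "'k::real_normed_field \<Rightarrow> 'a::{real_normed_algebra, monoid_mult, banach} \<Rightarrow> 'a"
      (infixr "\<cdot>" 75)
    and P Q :: 'a
    and a b :: 'k
  assumes "banach_algebra scale"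
    and "P ^ 2 = P" and "Q ^ 2 = Q"
    and "P * Q * P = P"
    and "a \<noteq> 0" and "b \<noteq> 0"
  shows "drazin_invertible (a \<cdot> P + b \<cdot> Q) \<and>
    drazin_inverse (a \<cdot> P + b \<cdot> Q) =
      (if a + b \<noteq> 0 then
         (a ^ 2 / (a + b) ^ 3) \<cdot> P + (1 / b) \<cdot> Q + (a * b / (a + b) ^ 3) \<cdot> (P * Q + Q * P)
           + (b ^ 2 / (a + b) ^ 3 - 1 / b) \<cdot> (Q * P * Q)
       else (1 / a) \<cdot> (Q * (P - 1) * Q)) \<and>
    drazin_index (a \<cdot> P - a \<cdot> Q) \<le> 3 \<and>
    (a + b \<noteq> 0 \<longrightarrow> drazin_index (a \<cdot> P + b \<cdot> Q) \<le> 2)"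
proof -
  interpret banach_algebra scale by fact
  have PQ: "P * P = P" "Q * Q = Q"
    using assms(2,3) by (simp_all add: power2_eq_square)
  note combination = drazin_witness_idempotent_combination[OF PQ \<open>P * Q * P = P\<close>]
  have index_diff: "drazin_index (a \<cdot> P - a \<cdot> Q) \<le> 3"
    using drazin_witnessD(3)[OF combination(2)[of "- a" a]] \<open>a \<noteq> 0\<close> by simp
  show ?thesis
  proof (cases "a + b = 0")
    case True
    then show ?thesis
      using drazin_witnessD[OF combination(2)[OF \<open>b \<noteq> 0\<close> True]] index_diff by simp
  next
    case False
    then show ?thesis
      using drazin_witnessD[OF combination(1)[OF \<open>b \<noteq> 0\<close> False]] index_diff by simp
  qed
qed

end
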